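(* Let $T=\{1,\dots,m\}$, let $a_t\in\mathbb{R}^n$ ($t\in T$) and $u\in\mathbb{R}^n$ be fixed, and for $b=(b_t)_{t\in T}\in\mathbb{R}^T$ let $\mathcal{F}(b):=\{x\in\mathbb{R}^n:\langle a_t,x\rangle\le b_t,\ t\in T\}$. Let $\widetilde{\mathcal{F}}(b)$ be the solution set of the linear inequality system $\{\langle a_{(t,s)},x\rangle\le b_{(t,s)},\ (t,s)\in\widetilde{T}\}$ defined in the context. Then for any $b\in\mathbb{R}^T$ we have $$\widetilde{\mathcal{F}}(b)=\mathcal{F}(b)+\mathrm{cone}\{u\}.$$
   Context: $\mathrm{cone}\{u\}=\{\mu u:\mu\ge0\}$. Set $T_1:=\{t\in T:\langle a_t,u\rangle\le0\}$, $T_2:=\{t\in T:\langle a_t,u\rangle>0\}$. For $t\in T_1$ put $a_{(t,0)}:=a_t$ and $b_{(t,0)}:=b_t$. For $(t,s)\in T_1\times T_2$ put $a_{(t,s)}:=\langle a_s,u\rangle a_t-\langle a_t,u\rangle a_s$ and $b_{(t,s)}:=\langle a_s,u\rangle b_t-\langle a_t,u\rangle b_s$. Set $\widetilde{T}:=T_1\times(\{0\}\cup T_2)$ and $\widetilde{\mathcal{F}}(b):=\{x\in\mathbb{R}^n:\langle a_{(t,s)},x\rangle\le b_{(t,s)}\ \text{for all }(t,s)\in\widetilde{T}\}$ (equal to $\mathbb{R}^n$ if $T_1=\emptyset$). *)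

theory Defs
  imports "HOL-Analysis.Analysis" "HOL-Library.Set_Algebras"
begin

text \<open>
  The constraints are indexed by the set \<open>{1..m}\<close>. Families \<open>a\<close> and \<open>b\<close> over it are
  total functions on \<open>nat\<close>; only their values on \<open>{1..m}\<close> matter. In particular \<open>0\<close> is not a
  constraint index, so it can serve as the extra symbol \<open>0\<close> in the pairs \<open>(t, 0)\<close>.
\<close>

definition feasible_set :: "nat \<Rightarrow> (nat \<Rightarrow> real ^ 'n) \<Rightarrow> (nat \<Rightarrow> real) \<Rightarrow> (real ^ 'n) set" where
  "feasible_set m a b = {x. \<forall>t\<in>{1..m}. a t \<bullet> x \<le> b t}"

definition cone_gen :: "real ^ 'n \<Rightarrow> (real ^ 'n) set" where
  "cone_gen u = {\<mu> *\<^sub>R u | \<mu>. \<mu> \<ge> 0}"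

lemma cone_gen_eq_cone_hull: "cone_gen u = cone hull {u}"
  by (auto simp: cone_gen_def cone_hull_expl)

definition T1 :: "nat \<Rightarrow> (nat \<Rightarrow> real ^ 'n) \<Rightarrow> real ^ 'n \<Rightarrow> nat set" where
  "T1 m a u = {t \<in> {1..m}. a t \<bullet> u \<le> 0}"

definition T2 :: "nat \<Rightarrow> (nat \<Rightarrow> real ^ 'n) \<Rightarrow> real ^ 'n \<Rightarrow> nat set" where
  "T2 m a u = {t \<in> {1..m}. a t \<bullet> u > 0}"

definition T_tilde :: "nat \<Rightarrow> (nat \<Rightarrow> real ^ 'n) \<Rightarrow> real ^ 'n \<Rightarrow> (nat \<times> nat) set" where
  "T_tilde m a u = T1 m a u \<times> ({0} \<union> T2 m a u)"

definition a_tilde :: "(nat \<Rightarrow> real ^ 'n) \<Rightarrow> real ^ 'n \<Rightarrow> nat \<times> nat \<Rightarrow> real ^ 'n" where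
  "a_tilde a u = (\<lambda>(t, s). if s = 0 then a t
                           else (a s \<bullet> u) *\<^sub>R a t - (a t \<bullet> u) *\<^sub>R a s)"

definition b_tilde ::
  "(nat \<Rightarrow> real ^ 'n) \<Rightarrow> real ^ 'n \<Rightarrow> (nat \<Rightarrow> real) \<Rightarrow> nat \<times> nat \<Rightarrow> real" where
  "b_tilde a u b = (\<lambda>(t, s). if s = 0 then b t
                             else (a s \<bullet> u) * b t - (a t \<bullet> u) * b s)"

definition feasible_set_tilde ::
  "nat \<Rightarrow> (nat \<Rightarrow> real ^ 'n) \<Rightarrow> real ^ 'n \<Rightarrow> (nat \<Rightarrow> real) \<Rightarrow> (real ^ 'n) set" where
  "feasible_set_tilde m a u b =
     {x. \<forall>p \<in> T_tilde m a u. a_tilde a u p \<bullet> x \<le> b_tilde a u b p}"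

end

theory Submission
  imports Defs
begin

text \<open>
  The identity is one step of Fourier--Motzkin elimination. A point \<open>x\<close> lies in
  \<open>feasible_set m a b + cone_gen u\<close> iff some \<open>\<mu> \<ge> 0\<close> makes \<open>x - \<mu> *\<^sub>R u\<close> feasible. For fixed \<open>x\<close>
  this is a system in the single unknown \<open>\<mu>\<close>: each \<open>s\<close> in \<open>T2\<close> gives the lower bound
  \<open>(a s \<bullet> x - b s) / (a s \<bullet> u)\<close>, the sign condition gives the lower bound \<open>0\<close>, and each \<open>t\<close> in
  \<open>T1\<close> gives an upper bound (or, if \<open>a t \<bullet> u = 0\<close>, a condition on \<open>x\<close> alone). Such a system is
  solvable iff its largest lower bound satisfies the constraints of \<open>T1\<close>, that is, iff every lower
  bound is compatible with every constraint of \<open>T1\<close>. The inequality indexed by \<open>(t, s)\<close> says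
  exactly this for the constraint \<open>t\<close> and the lower bound of \<open>s\<close>, and the one indexed by
  \<open>(t, 0)\<close> says it for the constraint \<open>t\<close> and the lower bound \<open>0\<close>.
\<close>

lemma feasible_set_tilde_iff:
  "x \<in> feasible_set_tilde m a u b \<longleftrightarrow>
     (\<forall>t \<in> T1 m a u. a t \<bullet> x \<le> b t \<and>
        (\<forall>s \<in> T2 m a u. (a s \<bullet> u) * (a t \<bullet> x - b t) \<le> (a t \<bullet> u) * (a s \<bullet> x - b s)))"
proof -
  have "s \<noteq> 0" if "s \<in> T2 m a u" for s
    using that by (auto simp: T2_def)
  then show ?thesis
    by (fastforce simp: feasible_set_tilde_def T_tilde_def a_tilde_def b_tilde_def
        inner_diff_left algebra_simps)
qed

text \<open>
  Both multipliers that form the inequality \<open>(t, s)\<close> are nonnegative, so it is a consequence of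
  the constraints \<open>t\<close> and \<open>s\<close>.
\<close>

lemma feasible_set_subset_feasible_set_tilde:
  "feasible_set m a b \<subseteq> feasible_set_tilde m a u b"
proof
  fix x assume x: "x \<in> feasible_set m a b"
  have "(a s \<bullet> u) * (a t \<bullet> x - b t) \<le> (a t \<bullet> u) * (a s \<bullet> x - b s)"
    if "t \<in> T1 m a u" "s \<in> T2 m a u" for t s
  proof -
    have "(a s \<bullet> u) * (a t \<bullet> x - b t) \<le> 0"
      using that x by (intro mult_nonneg_nonpos) (auto simp: feasible_set_def T1_def T2_def)
    also have "0 \<le> (a t \<bullet> u) * (a s \<bullet> x - b s)"
      using that x by (intro mult_nonpos_nonpos) (auto simp: feasible_set_def T1_def T2_def)
    finally show ?thesis .
  qed
  with x show "x \<in> feasible_set_tilde m a u b"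
    by (auto simp: feasible_set_tilde_iff feasible_set_def T1_def)
qed

text \<open>
  The direction \<open>u\<close> recedes in every inequality of the extended system: each \<open>(t, s)\<close> with \<open>s\<close>
  in \<open>T2\<close> has a normal vector orthogonal to \<open>u\<close>, and \<open>a t \<bullet> u \<le> 0\<close> for \<open>t\<close> in \<open>T1\<close>.
\<close>

lemma feasible_set_tilde_add_direction:
  assumes "x \<in> feasible_set_tilde m a u b" "\<mu> \<ge> 0"
  shows "x + \<mu> *\<^sub>R u \<in> feasible_set_tilde m a u b"
  unfolding feasible_set_tilde_iff
proof (intro ballI conjI)
  fix t assume t: "t \<in> T1 m a u"
  have "\<mu> * (a t \<bullet> u) \<le> 0"
    using t assms(2) by (simp add: T1_def mult_nonneg_nonpos)
  then show "a t \<bullet> (x + \<mu> *\<^sub>R u) \<le> b t"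
    using t assms(1) by (fastforce simp: feasible_set_tilde_iff inner_add_right)
  fix s assume "s \<in> T2 m a u"
  then show "(a s \<bullet> u) * (a t \<bullet> (x + \<mu> *\<^sub>R u) - b t) \<le> (a t \<bullet> u) * (a s \<bullet> (x + \<mu> *\<^sub>R u) - b s)"
    using t assms(1) by (auto simp: feasible_set_tilde_iff inner_add_right algebra_simps)
qed

text \<open>
  The smallest admissible \<open>\<mu>\<close>, the largest of the lower bounds, works: it meets all constraints of
  \<open>T2\<close> by its choice, and since it equals one of the bounds, a single inequality of the extended
  system yields each constraint of \<open>T1\<close>.
\<close>

lemma feasible_set_tilde_imp_ex_shift:
  assumes x: "x \<in> feasible_set_tilde m a u b"
  shows "\<exists>\<mu>\<ge>0. x - \<mu> *\<^sub>R u \<in> feasible_set m a b"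
proof -
  define r where "r s = (a s \<bullet> x - b s) / (a s \<bullet> u)" for s
  \<comment> \<open>Inserting \<open>0\<close> enforces \<open>\<mu> \<ge> 0\<close> and keeps the maximum meaningful when \<open>T2\<close> is empty.\<close>
  define \<mu> where "\<mu> = Max (insert 0 (r ` T2 m a u))"
  have fin: "finite (insert 0 (r ` T2 m a u))"
    by (simp add: T2_def)
  have nonneg: "\<mu> \<ge> 0"
    unfolding \<mu>_def using fin by (intro Max_ge) auto
  have lower: "r s \<le> \<mu>" if "s \<in> T2 m a u" for s
    unfolding \<mu>_def using fin that by (intro Max_ge) auto
  have attained: "\<mu> = 0 \<or> (\<exists>s \<in> T2 m a u. \<mu> = r s)"
    using Max_in[OF fin] unfolding \<mu>_def by auto
  have "a t \<bullet> x - \<mu> * (a t \<bullet> u) \<le> b t" if t: "t \<in> {1..m}" for t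
  proof (cases "a t \<bullet> u > 0")
    case True
    with t have "r t \<le> \<mu>"
      by (intro lower) (simp add: T2_def)
    with True show ?thesis
      by (simp add: r_def pos_divide_le_eq)
  next
    case False
    with t have t1: "t \<in> T1 m a u"
      by (simp add: T1_def)
    from attained show ?thesis
    proof
      assume "\<mu> = 0"
      with t1 x show ?thesis
        by (simp add: feasible_set_tilde_iff)
    next
      assume "\<exists>s \<in> T2 m a u. \<mu> = r s"
      then obtain s where s: "s \<in> T2 m a u" "\<mu> = r s"
        by blast
      then have pos: "a s \<bullet> u > 0"
        by (simp add: T2_def)
      have "(a t \<bullet> x - b t) * (a s \<bullet> u) \<le> (a t \<bullet> u) * (a s \<bullet> x - b s)"
        using x t1 s(1) by (simp add: feasible_set_tilde_iff mult.commute)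
      then have "a t \<bullet> x - b t \<le> (a t \<bullet> u) * (a s \<bullet> x - b s) / (a s \<bullet> u)"
        using pos by (simp only: pos_le_divide_eq)
      then show ?thesis
        by (simp add: s(2) r_def mult.commute)
    qed
  qed
  with nonneg show ?thesis
    by (auto simp: feasible_set_def inner_diff_right)
qed

theorem theorem5:
  fixes m :: nat and a :: "nat \<Rightarrow> real ^ 'n" and u :: "real ^ 'n" and b :: "nat \<Rightarrow> real"
  shows "feasible_set_tilde m a u b = feasible_set m a b + cone_gen u"
proof
  show "feasible_set_tilde m a u b \<subseteq> feasible_set m a b + cone_gen u"
  proof
    fix x assume "x \<in> feasible_set_tilde m a u b"
    then obtain \<mu> where "\<mu> \<ge> 0" "x - \<mu> *\<^sub>R u \<in> feasible_set m a b"
      using feasible_set_tilde_imp_ex_shift by blast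
    then have "(x - \<mu> *\<^sub>R u) + \<mu> *\<^sub>R u \<in> feasible_set m a b + cone_gen u"
      by (intro set_plus_intro) (auto simp: cone_gen_def)
    then show "x \<in> feasible_set m a b + cone_gen u"
      by simp
  qed
next
  show "feasible_set m a b + cone_gen u \<subseteq> feasible_set_tilde m a u b"
    using feasible_set_subset_feasible_set_tilde feasible_set_tilde_add_direction
    by (fastforce simp: cone_gen_def elim!: set_plus_elim)
qed

end
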